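(* Let the state $r_t$ follow the Gauss–Markov (random walk) process $r_t=r_{t-1}+w_{t-1}$, $w_{t-1}\sim\mathcal N(0,Q)$, with observations $z_t=r_t+v_t$, $v_t\sim\mathcal N(0,R)$ (available at steps where the full computation is performed), and consider the recursive estimator described in the context, with gain (Calibrated Fusion Factor) $K_t$ and posterior estimation error variance $P_{t|t}$. Consider steady-state estimation, where $K_t$ converges to a constant $K_\infty$, and let $P_\infty$ be the steady-state posterior estimation error variance. Then $P_\infty$ satisfies the algebraic Riccati equation $$P_\infty=(I-K_\infty)(P_\infty+Q),\qquad K_\infty=(P_\infty+Q)(P_\infty+Q+R)^{-1}$$ (for a one-dimensional state this is $P_\infty^2+QP_\infty-QR=0$). For any zero-order heuristic that uses the previous observation $z_{t-1}$ as the estimate of $r_t$, the estimation error variance is $$\sigma^2_{\mathrm{ZOH}}=Q+R.$$ Moreover, $$P_\infty<\sigma^2_{\mathrm{ZOH}},$$ provided $R>0$ and $Q>0$.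
   Context: The state $r_t$ may be one-dimensional or multi-dimensional; $Q$ (process noise covariance) and $R$ (measurement noise covariance) are constant in $t$, and $I$ is the identity matrix. When the state dimension is 1 all quantities are scalars and $I=1$. For multi-dimensional states, variances are covariance matrices (the error variance of an estimate $\hat r_t$ with error $e=\hat r_t-r_t$ is $\mathbb E[ee^{\top}]$, which is $\mathbb E[e^2]$ for scalars), and $>0$ and $<$ are read in the positive definite order. The noise processes $w$ and $v$ are zero-mean and independent. The estimator starts from an initial estimate $\hat r_0$ and an initial error covariance $P_0$ that reflects the initial uncertainty. At each step it performs the prior projection $$\hat r_{t|t-1}=\hat r_{t-1|t-1},\qquad P_{t|t-1}=P_{t-1|t-1}+Q.$$ When an observation $z_t$ is available, it performs the rectification $$\hat r_{t|t}=(I-K_t)\hat r_{t|t-1}+K_tz_t,\qquad K_t=P_{t|t-1}(P_{t|t-1}+R)^{-1},\qquad P_{t|t}=(I-K_t)P_{t|t-1},$$ where $K_t$, the optimal Calibrated Fusion Factor, is chosen to minimize the posterior estimation uncertainty $P_{t|t}$. When no observation is available, the estimator continues to rely on its prior prediction. Steady state ($t\to\infty$) means that the posterior uncertainty $P_{t|t}$ given by the rectification converges to a constant $P_\infty$ and the prior uncertainty $P_{t|t-1}$ converges to a constant $P_\infty^-$, with $P_\infty^-=P_\infty+Q$ and $K_\infty=P_\infty^-(P_\infty^-+R)^{-1}$. The zero-order heuristic is $\hat r_t^{\mathrm{ZOH}}=z_{t-1}$ (the computation at step $t-1$ having been performed, so that $z_{t-1}$ is available), and $\sigma^2_{\mathrm{ZOH}}$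 is the error variance of $\hat r_t^{\mathrm{ZOH}}$ as an estimate of $r_t$. *)

theory Defs
  imports "HOL-Probability.Probability"
begin

definition pos_semidef :: "real^'n^'n \<Rightarrow> bool" where
  "pos_semidef A \<longleftrightarrow> transpose A = A \<and> (\<forall>x. 0 \<le> x \<bullet> (A *v x))"

definition pos_def :: "real^'n^'n \<Rightarrow> bool" where
  "pos_def A \<longleftrightarrow> transpose A = A \<and> (\<forall>x. x \<noteq> 0 \<longrightarrow> 0 < x \<bullet> (A *v x))"

definition pd_less :: "real^'n^'n \<Rightarrow> real^'n^'n \<Rightarrow> bool" where
  "pd_less A B \<longleftrightarrow> pos_def (B - A)"

text \<open>
  \<open>X\<close> has law $\mathcal N(0,S)$: every linear functional of \<open>X\<close> is a centred real Gaussian with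
  the variance prescribed by \<open>S\<close>. Singular \<open>S\<close> is allowed, and a functional of variance \<open>0\<close>
  vanishes almost surely. Note that \<open>normal_density\<close> takes the standard deviation.
\<close>

definition gaussian0 :: "'a measure \<Rightarrow> real^'n^'n \<Rightarrow> ('a \<Rightarrow> real^'n) \<Rightarrow> bool" where
  "gaussian0 M S X \<longleftrightarrow>
     X \<in> borel_measurable M \<and> pos_semidef S \<and>
     (\<forall>a. if a \<bullet> (S *v a) = 0 then AE \<omega> in M. a \<bullet> X \<omega> = 0
          else distributed M lborel (\<lambda>\<omega>. a \<bullet> X \<omega>) (normal_density 0 (sqrt (a \<bullet> (S *v a)))))"

definition outer :: "real^'n \<Rightarrow> real^'n^'n" where
  "outer e = (\<chi> i j. e $ i * e $ j)"

definition finite_error_variance ::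
    "'a measure \<Rightarrow> ('a \<Rightarrow> real^'n) \<Rightarrow> ('a \<Rightarrow> real^'n) \<Rightarrow> bool" where
  "finite_error_variance M est x \<longleftrightarrow> integrable M (\<lambda>\<omega>. outer (est \<omega> - x \<omega>))"

text \<open>The integral is \<open>0\<close> by convention unless \<^const>\<open>finite_error_variance\<close> holds.\<close>

definition error_variance ::
    "'a measure \<Rightarrow> ('a \<Rightarrow> real^'n) \<Rightarrow> ('a \<Rightarrow> real^'n) \<Rightarrow> real^'n^'n" where
  "error_variance M est x = (\<integral>\<omega>. outer (est \<omega> - x \<omega>) \<partial>M)"

text \<open>
  \<open>obs\<close> is the set of steps at which an observation is available; \<open>z t\<close> is unconstrained elsewhere.
  All the noise vectors \<open>w t\<close>, \<open>v t\<close> are mutually independent (indexed by a disjoint sum).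
\<close>

definition random_walk_model ::
    "'a measure \<Rightarrow> real^'n^'n \<Rightarrow> real^'n^'n \<Rightarrow> nat set \<Rightarrow>
     (nat \<Rightarrow> 'a \<Rightarrow> real^'n) \<Rightarrow> (nat \<Rightarrow> 'a \<Rightarrow> real^'n) \<Rightarrow>
     (nat \<Rightarrow> 'a \<Rightarrow> real^'n) \<Rightarrow> (nat \<Rightarrow> 'a \<Rightarrow> real^'n) \<Rightarrow> bool" where
  "random_walk_model M Q R obs w v r z \<longleftrightarrow>
     prob_space M \<and>
     (\<forall>t. gaussian0 M Q (w t)) \<and>
     (\<forall>t. gaussian0 M R (v t)) \<and>
     prob_space.indep_vars M (\<lambda>_. borel) (case_sum w v) UNIV \<and>
     r 0 \<in> borel_measurable M \<and>
     (\<forall>t \<omega>. r (Suc t) \<omega> = r t \<omega> + w t \<omega>) \<and>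
     (\<forall>t\<in>obs. \<forall>\<omega>. z t \<omega> = r t \<omega> + v t \<omega>)"

text \<open>
  Index \<open>t\<close> of \<open>rprior\<close>, \<open>Pprior\<close> stands for $t|t-1$ (so \<open>t \<ge> 1\<close>) and index \<open>t\<close> of \<open>rpost\<close>,
  \<open>Ppost\<close> for $t|t$; the initial data are \<open>rpost 0\<close> and \<open>Ppost 0\<close>. The invertibility requirement
  makes the inverse in the gain meaningful; it is automatic when \<open>R\<close> is positive definite.
\<close>

definition fusion_estimator ::
    "real^'n^'n \<Rightarrow> real^'n^'n \<Rightarrow> nat set \<Rightarrow> (nat \<Rightarrow> 'a \<Rightarrow> real^'n) \<Rightarrow>
     (nat \<Rightarrow> 'a \<Rightarrow> real^'n) \<Rightarrow> (nat \<Rightarrow> 'a \<Rightarrow> real^'n) \<Rightarrow>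
     (nat \<Rightarrow> real^'n^'n) \<Rightarrow> (nat \<Rightarrow> real^'n^'n) \<Rightarrow> (nat \<Rightarrow> real^'n^'n) \<Rightarrow> bool" where
  "fusion_estimator Q R obs z rprior rpost K Pprior Ppost \<longleftrightarrow>
     pos_semidef (Ppost 0) \<and>
     (\<forall>t. rprior (Suc t) = rpost t \<and> Pprior (Suc t) = Ppost t + Q) \<and>
     (\<forall>t\<ge>1. t \<in> obs \<longrightarrow>
        invertible (Pprior t + R) \<and>
        K t = Pprior t ** matrix_inv (Pprior t + R) \<and>
        (\<forall>\<omega>. rpost t \<omega> = (mat 1 - K t) *v rprior t \<omega> + K t *v z t \<omega>) \<and>
        Ppost t = (mat 1 - K t) ** Pprior t) \<and>
     (\<forall>t\<ge>1. t \<notin> obs \<longrightarrow> rpost t = rprior t \<and> Ppost t = Pprior t)"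

text \<open>
  The gain and the rectified posterior exist only at steps in \<open>obs\<close>, so their limits are taken
  along \<open>obs\<close>, whereas the prior variance is required to converge along all steps. That the
  limits satisfy $P_\infty^- = P_\infty + Q$ and $K_\infty = P_\infty^-(P_\infty^- + R)^{-1}$ is
  not assumed, only that the latter inverse exists (again automatic for positive definite \<open>R\<close>).
\<close>

definition steady_state ::
    "real^'n^'n \<Rightarrow> nat set \<Rightarrow>
     (nat \<Rightarrow> real^'n^'n) \<Rightarrow> (nat \<Rightarrow> real^'n^'n) \<Rightarrow> (nat \<Rightarrow> real^'n^'n) \<Rightarrow>
     real^'n^'n \<Rightarrow> real^'n^'n \<Rightarrow> real^'n^'n \<Rightarrow> bool" where
  "steady_state R obs K Pprior Ppost K_inf Pprior_inf P_inf \<longleftrightarrow>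
     infinite obs \<and>
     (K \<longlongrightarrow> K_inf) (inf sequentially (principal obs)) \<and>
     (Ppost \<longlongrightarrow> P_inf) (inf sequentially (principal obs)) \<and>
     Pprior \<longlonglongrightarrow> Pprior_inf \<and>
     invertible (Pprior_inf + R)"

text \<open>
  \<open>P0\<close> is the actual error variance of the initial estimate \<open>est0\<close> of \<open>r0\<close>, and the initial error
  is independent of the noise entering the estimator afterwards. As \<open>v 0\<close> is left out, an
  initialisation from the observation at time \<open>0\<close> is admitted.
\<close>

definition initial_uncertainty ::
    "'a measure \<Rightarrow> (nat \<Rightarrow> 'a \<Rightarrow> real^'n) \<Rightarrow> (nat \<Rightarrow> 'a \<Rightarrow> real^'n) \<Rightarrow>
     ('a \<Rightarrow> real^'n) \<Rightarrow> ('a \<Rightarrow> real^'n) \<Rightarrow> real^'n^'n \<Rightarrow> bool" where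
  "initial_uncertainty M w v est0 r0 P0 \<longleftrightarrow>
     finite_error_variance M est0 r0 \<and> error_variance M est0 r0 = P0 \<and>
     prob_space.indep_vars M (\<lambda>_. borel)
       (case_option (\<lambda>\<omega>. est0 \<omega> - r0 \<omega>) (case_sum w (\<lambda>t. v (Suc t)))) UNIV"

definition zoh :: "(nat \<Rightarrow> 'a \<Rightarrow> real^'n) \<Rightarrow> nat \<Rightarrow> 'a \<Rightarrow> real^'n" where
  "zoh z t = z (t - 1)"

end

theory Submission imports Defs begin

text \<open>
  Write $A = P_\infty + Q$, $S = A + R$ and $L = I - K_\infty$. Clearing the inverse, the gain
  equation reads $K_t (P_{t|t-1} + R) = P_{t|t-1}$, which passes to the limit without continuity of
  matrix inversion. It gives $P_\infty = L A = K_\infty R$ and $L S = R$, whence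
  $R - P_\infty = L S L^\top \ge 0$, and $Q + R - P_\infty \ge Q > 0$. The error of the zero-order
  heuristic is $v_{t-1} - w_{t-1}$, with uncorrelated summands.
\<close>

section \<open>Matrix algebra and the semidefinite order\<close>

lemma matrix_diff_ldistrib: "A ** (B - C) = A ** B - A ** C" for A :: "real^'m^'n"
  by (simp add: matrix_matrix_mult_def vec_eq_iff sum_subtractf algebra_simps)

lemma matrix_diff_rdistrib: "(A - B) ** C = A ** C - B ** C" for A :: "real^'m^'n"
  by (simp add: matrix_matrix_mult_def vec_eq_iff sum_subtractf algebra_simps)

lemma matrix_add_rdistrib: "(A + B) ** C = A ** C + B ** C" for A :: "real^'m^'n"
  by (simp add: matrix_matrix_mult_def vec_eq_iff sum.distrib algebra_simps)

lemma transpose_add: "transpose (A + B) = transpose A + transpose B" for A :: "real^'m^'n"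
  by (simp add: transpose_def vec_eq_iff)

lemma transpose_diff: "transpose (A - B) = transpose A - transpose B" for A :: "real^'m^'n"
  by (simp add: transpose_def vec_eq_iff)

lemma tendsto_matrix_mult:
  fixes A :: "'b \<Rightarrow> real^'m^'n" and B :: "'b \<Rightarrow> real^'k^'m"
  assumes "(A \<longlongrightarrow> a) F" "(B \<longlongrightarrow> b) F"
  shows "((\<lambda>t. A t ** B t) \<longlongrightarrow> a ** b) F"
  unfolding matrix_matrix_mult_def
  by (intro tendsto_vec_lambda tendsto_sum tendsto_mult tendsto_vec_nth assms)

lemma inner_matrix_congruence:
  "x \<bullet> ((B ** A ** transpose B) *v x) = (transpose B *v x) \<bullet> (A *v (transpose B *v x))"
  for A :: "real^'n^'n" and B :: "real^'n^'m"
  by (simp add: dot_lmul_matrix flip: matrix_vector_mul_assoc)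

lemma pos_semidef_congruence:
  assumes "pos_semidef A"
  shows "pos_semidef (B ** A ** transpose B)"
  using assms inner_matrix_congruence[of _ B A] unfolding pos_semidef_def
  by (simp add: matrix_transpose_mul matrix_mul_assoc del: transpose_matrix_vector)

lemma pos_semidef_add: "pos_semidef A \<Longrightarrow> pos_semidef B \<Longrightarrow> pos_semidef (A + B)"
  by (simp add: pos_semidef_def transpose_add matrix_vector_mult_add_rdistrib inner_add_right)

lemma pos_def_add_pos_semidef: "pos_def A \<Longrightarrow> pos_semidef B \<Longrightarrow> pos_def (A + B)"
  by (simp add: pos_semidef_def pos_def_def transpose_add matrix_vector_mult_add_rdistrib
      inner_add_right add_pos_nonneg)

text \<open>Symmetry and each inequality \<open>0 \<le> x \<bullet> (A *v x)\<close> are closed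
  conditions on the entries, so they survive limits. This carries semidefiniteness from the
  posteriors to \<open>P_inf\<close>.\<close>

lemma pos_semidef_limit:
  fixes A :: "'b \<Rightarrow> real^'n^'n"
  assumes "(A \<longlongrightarrow> a) F" "F \<noteq> bot" "\<forall>\<^sub>F t in F. pos_semidef (A t)"
  shows "pos_semidef a"
  unfolding pos_semidef_def
proof (intro conjI allI)
  have "((\<lambda>t. transpose (A t)) \<longlongrightarrow> transpose a) F"
    unfolding transpose_def by (intro tendsto_vec_lambda tendsto_vec_nth assms)
  moreover have "\<forall>\<^sub>F t in F. A t = transpose (A t)"
    using assms(3) by eventually_elim (simp add: pos_semidef_def)
  ultimately have "(A \<longlongrightarrow> transpose a) F"
    by (simp add: tendsto_cong)
  then show "transpose a = a"
    using assms(1,2) tendsto_unique by blast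
  fix x
  have "((\<lambda>t. x \<bullet> (A t *v x)) \<longlongrightarrow> x \<bullet> (a *v x)) F"
    unfolding matrix_vector_mult_def
    by (intro tendsto_inner tendsto_const tendsto_vec_lambda tendsto_sum tendsto_mult
        tendsto_vec_nth assms)
  then show "0 \<le> x \<bullet> (a *v x)"
    using assms(2,3) by (intro tendsto_lowerbound) (auto elim!: eventually_mono simp: pos_semidef_def)
qed

section \<open>Algebraic identities for the gain\<close>

lemma gain_mult_noise:
  fixes A R K :: "real^'n^'n"
  assumes "K ** (A + R) = A"
  shows "K ** R = (mat 1 - K) ** A"
  using assms by (simp add: matrix_diff_rdistrib matrix_add_ldistrib algebra_simps)

text \<open>Replacing \<open>K ** R\<close> by \<open>(mat 1 - K) ** A\<close> makes the two terms
  containing \<open>transpose K\<close> cancel. The left side is the covariance of (I-K)d + Kv for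
  uncorrelated d and v with covariances \<open>A\<close> and \<open>R\<close>; unlike the right
  side, it is visibly semidefinite when \<open>A\<close> and \<open>R\<close> are.\<close>

lemma joseph_form:
  fixes A R K :: "real^'n^'n"
  assumes "K ** (A + R) = A"
  shows "(mat 1 - K) ** A ** transpose (mat 1 - K) + K ** R ** transpose K = (mat 1 - K) ** A"
  unfolding gain_mult_noise[OF assms]
  by (simp add: transpose_diff matrix_diff_ldistrib)

text \<open>Since (I-K)(A+R) = R, the right side is R - R K^T, and R K^T = A - A K^T by the
  transposed gain equation. What remains is KA = A K^T.\<close>

lemma noise_minus_posterior:
  fixes A R K :: "real^'n^'n"
  assumes K: "K ** (A + R) = A" and sym: "transpose A = A" "transpose R = R"
  shows "R - (mat 1 - K) ** A = (mat 1 - K) ** (A + R) ** transpose (mat 1 - K)"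
proof -
  have KT: "(A + R) ** transpose K = A"
    using arg_cong[OF K, of transpose] by (simp add: matrix_transpose_mul transpose_add sym)
  \<comment> \<open>K(A+R)K^T is evaluated in two ways: contracting the right pair gives KA,
    contracting the left pair gives A K^T.\<close>
  have "K ** A = K ** ((A + R) ** transpose K)"
    by (simp only: KT)
  also have "\<dots> = A ** transpose K"
    by (simp only: matrix_mul_assoc K)
  finally have comm: "K ** A = A ** transpose K" .
  have gain: "(mat 1 - K) ** (A + R) = R"
    using K by (simp add: matrix_diff_rdistrib)
  have "R ** transpose K = A - A ** transpose K"
    using KT by (simp add: matrix_add_rdistrib algebra_simps)
  then show ?thesis
    unfolding gain by (simp add: matrix_diff_rdistrib matrix_diff_ldistrib transpose_diff comm)
qed

text \<open>Over a one-element index type matrix products are products of entries. The two equations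
  become kr = p and k(p+q) = q, and k is eliminated without division through p(p+q) = kr(p+q) =
  qr.\<close>

lemma riccati_scalar:
  fixes P Q R K :: "real^'n^'n"
  assumes "CARD('n) = 1" and P: "P = (mat 1 - K) ** (P + Q)" and K: "K ** (P + Q + R) = P + Q"
  shows "(P $ i $ i)\<^sup>2 + Q $ i $ i * P $ i $ i - Q $ i $ i * R $ i $ i = 0"
proof -
  obtain j :: 'n where "UNIV = {j}"
    using assms(1) card_1_singletonE by blast
  then have U: "UNIV = {i}" by (metis UNIV_I singletonD)
  have m: "(A ** B) $ i $ i = A $ i $ i * B $ i $ i" for A B :: "real^'n^'n"
    by (simp add: matrix_matrix_mult_def U)
  define p q r k where "p = P $ i $ i" and "q = Q $ i $ i" and "r = R $ i $ i" and "k = K $ i $ i"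
  have 1: "p = (1 - k) * (p + q)"
    using arg_cong[OF P, of "\<lambda>A. A $ i $ i"] unfolding m by (simp add: p_def q_def k_def mat_def)
  have 2: "k * (p + q + r) = p + q"
    using arg_cong[OF K, of "\<lambda>A. A $ i $ i"] unfolding m by (simp add: p_def q_def k_def r_def)
  have "k * r = p" using 1 2 by (simp add: algebra_simps)
  moreover have "k * (p + q) = q" using 1 by (simp add: algebra_simps)
  ultimately have "p * (p + q) = q * r" by (metis mult.assoc mult.commute)
  then show ?thesis by (simp add: p_def q_def r_def power2_eq_square algebra_simps)
qed

section \<open>Second moments of random vectors\<close>

definition square_integrable :: "'a measure \<Rightarrow> ('a \<Rightarrow> real^'n) \<Rightarrow> bool" where
  "square_integrable M X \<longleftrightarrow>
     X \<in> borel_measurable M \<and> (\<forall>i. integrable M (\<lambda>\<omega>. (X \<omega> $ i)\<^sup>2))"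

text \<open>The uncentred matrix E[X Y^T]: error variances are second moments, and the initial error
  is not assumed centred. It is a covariance as soon as one of the two vectors has mean
  zero.\<close>

definition cross :: "'a measure \<Rightarrow> ('a \<Rightarrow> real^'n) \<Rightarrow> ('a \<Rightarrow> real^'m) \<Rightarrow> real^'m^'n" where
  "cross M X Y = (\<chi> i j. \<integral>\<omega>. X \<omega> $ i * Y \<omega> $ j \<partial>M)"

lemma borel_measurable_vec_nth [measurable]: "(\<lambda>x::real^'n. x $ i) \<in> borel_measurable borel"
  by (intro borel_measurable_continuous_onI continuous_intros)

text \<open>The product is dominated by the sum of the two squares. Integrability of every such
  product is what makes \<open>cross\<close> bilinear on square integrable vectors.\<close>

lemma square_integrable_mult:
  assumes "square_integrable M X" "square_integrable M Y"
  shows "integrable M (\<lambda>\<omega>. X \<omega> $ i * Y \<omega> $ j)"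
proof (rule Bochner_Integration.integrable_bound)
  show "integrable M (\<lambda>\<omega>. (X \<omega> $ i)\<^sup>2 + (Y \<omega> $ j)\<^sup>2)"
    using assms by (auto simp: square_integrable_def)
  have [measurable]: "X \<in> borel_measurable M" "Y \<in> borel_measurable M"
    using assms by (auto simp: square_integrable_def)
  show "(\<lambda>\<omega>. X \<omega> $ i * Y \<omega> $ j) \<in> borel_measurable M"
    by measurable
  have "\<bar>x * y\<bar> \<le> x\<^sup>2 + y\<^sup>2" for x y :: real
  proof -
    have "2 * (\<bar>x\<bar> * \<bar>y\<bar>) \<le> x\<^sup>2 + y\<^sup>2" and "0 \<le> \<bar>x\<bar> * \<bar>y\<bar>"
      using sum_squares_bound[of "\<bar>x\<bar>" "\<bar>y\<bar>"] by simp_all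
    then show ?thesis unfolding abs_mult by linarith
  qed
  then show "AE \<omega> in M. norm (X \<omega> $ i * Y \<omega> $ j) \<le> norm ((X \<omega> $ i)\<^sup>2 + (Y \<omega> $ j)\<^sup>2)"
    by simp
qed

lemma square_integrable_add:
  assumes "square_integrable M X" "square_integrable M Y"
  shows "square_integrable M (\<lambda>\<omega>. X \<omega> + Y \<omega>)"
  using assms square_integrable_mult[OF assms]
  by (auto simp: square_integrable_def power2_sum mult.assoc)

lemma square_integrable_diff:
  assumes "square_integrable M X" "square_integrable M Y"
  shows "square_integrable M (\<lambda>\<omega>. X \<omega> - Y \<omega>)"
  using assms square_integrable_mult[OF assms]
  by (auto simp: square_integrable_def power2_diff mult.assoc)

lemma square_integrable_matrix_vector:
  fixes A :: "real^'n^'m"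
  assumes "square_integrable M X"
  shows "square_integrable M (\<lambda>\<omega>. A *v X \<omega>)"
proof -
  have "integrable M (\<lambda>\<omega>. A $ i $ j * X \<omega> $ j * (A $ i $ k * X \<omega> $ k))" for i j k
    using integrable_mult_right[OF square_integrable_mult[OF assms assms], of "A $ i $ j * A $ i $ k" j k]
    by (simp add: mult_ac)
  moreover have "(\<lambda>x. A *v x) \<in> borel_measurable borel"
    by (intro borel_measurable_continuous_onI continuous_intros)
  ultimately show ?thesis
    using assms measurable_compose[of X M borel "\<lambda>x. A *v x" borel]
    by (auto simp: square_integrable_def matrix_vector_mult_def power2_eq_square sum_product)
qed

lemma cross_add_left:
  assumes "square_integrable M X" "square_integrable M Y" "square_integrable M Z"
  shows "cross M (\<lambda>\<omega>. X \<omega> + Y \<omega>) Z = cross M X Z + cross M Y Z"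
  using assms by (simp add: cross_def vec_eq_iff distrib_right square_integrable_mult)

lemma cross_diff_left:
  assumes "square_integrable M X" "square_integrable M Y" "square_integrable M Z"
  shows "cross M (\<lambda>\<omega>. X \<omega> - Y \<omega>) Z = cross M X Z - cross M Y Z"
  using assms by (simp add: cross_def vec_eq_iff left_diff_distrib square_integrable_mult)

lemma cross_matrix_vector_left:
  assumes "square_integrable M X" "square_integrable M Y"
  shows "cross M (\<lambda>\<omega>. A *v X \<omega>) Y = A ** cross M X Y"
  using assms by (simp add: cross_def vec_eq_iff matrix_vector_mult_def matrix_matrix_mult_def
      sum_distrib_right mult.assoc square_integrable_mult)

lemma transpose_cross: "transpose (cross M X Y) = cross M Y X"
  by (simp add: cross_def transpose_def vec_eq_iff mult.commute)

lemma cross_add_right: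
  assumes "square_integrable M X" "square_integrable M Y" "square_integrable M Z"
  shows "cross M Z (\<lambda>\<omega>. X \<omega> + Y \<omega>) = cross M Z X + cross M Z Y"
  using assms by (simp add: cross_def vec_eq_iff distrib_left square_integrable_mult)

lemma cross_diff_right:
  assumes "square_integrable M X" "square_integrable M Y" "square_integrable M Z"
  shows "cross M Z (\<lambda>\<omega>. X \<omega> - Y \<omega>) = cross M Z X - cross M Z Y"
  using assms by (simp add: cross_def vec_eq_iff right_diff_distrib square_integrable_mult)

lemma cross_matrix_vector_right:
  assumes "square_integrable M X" "square_integrable M Y"
  shows "cross M Y (\<lambda>\<omega>. A *v X \<omega>) = cross M Y X ** transpose A"
  using cross_matrix_vector_left[OF assms, of A]
  by (metis matrix_transpose_mul transpose_cross)

section \<open>Matrix-valued integrals of outer products\<close>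

lemma outer_nth [simp]: "outer e $ i $ j = e $ i * e $ j"
  by (simp add: outer_def)

lemma integrable_vec_nth: "integrable M f \<Longrightarrow> integrable M (\<lambda>\<omega>. f \<omega> $ i)"
  for f :: "'a \<Rightarrow> 'b::euclidean_space^'n"
  by (rule integrable_bounded_linear[OF bounded_linear_vec_nth])

lemma integral_vec_nth: "integrable M f \<Longrightarrow> (\<integral>\<omega>. f \<omega> \<partial>M) $ i = (\<integral>\<omega>. f \<omega> $ i \<partial>M)"
  for f :: "'a \<Rightarrow> 'b::euclidean_space^'n"
  by (rule integral_bounded_linear[OF bounded_linear_vec_nth, symmetric])

lemma integrable_outer:
  assumes "square_integrable M e"
  shows "integrable M (\<lambda>\<omega>. outer (e \<omega>))"
proof -
  have "integrable M (\<lambda>\<omega>. outer (e \<omega>) \<bullet> b)" if "b \<in> Basis" for b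
    using that assms
    by (auto simp: Basis_vec_def inner_axis square_integrable_mult)
  \<comment> \<open>The matrix is reassembled from its components along the standard basis, which
    are its entries.\<close>
  then have "integrable M (\<lambda>\<omega>. \<Sum>b\<in>Basis. (outer (e \<omega>) \<bullet> b) *\<^sub>R b)"
    by (intro Bochner_Integration.integrable_sum) simp
  then show ?thesis by (simp add: euclidean_representation)
qed

lemma integral_outer:
  assumes "integrable M (\<lambda>\<omega>. outer (e \<omega>))"
  shows "(\<integral>\<omega>. outer (e \<omega>) \<partial>M) = cross M e e"
  using integrable_vec_nth[OF assms]
  by (simp add: vec_eq_iff cross_def integral_vec_nth assms)

text \<open>The diagonal of the outer product consists of the squares. The outer product determines
  \<open>e\<close> only up to sign, so measurability of \<open>e\<close> is a separate
  hypothesis.\<close>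

lemma square_integrable_of_outer:
  assumes "e \<in> borel_measurable M" "integrable M (\<lambda>\<omega>. outer (e \<omega>))"
  shows "square_integrable M e"
  unfolding square_integrable_def
proof (intro conjI allI assms)
  fix i
  show "integrable M (\<lambda>\<omega>. (e \<omega> $ i)\<^sup>2)"
    using integrable_vec_nth[OF integrable_vec_nth[OF assms(2)], of i i]
    by (simp add: power2_eq_square)
qed

section \<open>Gaussian moments and independence\<close>

context prob_space
begin

lemma normal_second_moment:
  assumes "0 < \<sigma>" and D: "distributed M lborel X (normal_density 0 \<sigma>)"
  shows "expectation X = 0" "integrable M (\<lambda>\<omega>. (X \<omega>)\<^sup>2)" "expectation (\<lambda>\<omega>. (X \<omega>)\<^sup>2) = \<sigma>\<^sup>2"
proof -
  show "expectation X = 0"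
    by (rule normal_distributed_expectation[OF assms])
  then show "expectation (\<lambda>\<omega>. (X \<omega>)\<^sup>2) = \<sigma>\<^sup>2"
    using normal_distributed_variance[OF assms] by simp
  show "integrable M (\<lambda>\<omega>. (X \<omega>)\<^sup>2)"
    using integrable_normal_moment[OF assms(1), of 0 2]
    by (subst (asm) distributed_integrable[OF D]) simp_all
qed

lemma gaussian0_functional:
  assumes "gaussian0 M S X"
  shows "expectation (\<lambda>\<omega>. a \<bullet> X \<omega>) = 0" "integrable M (\<lambda>\<omega>. (a \<bullet> X \<omega>)\<^sup>2)"
    "expectation (\<lambda>\<omega>. (a \<bullet> X \<omega>)\<^sup>2) = a \<bullet> (S *v a)"
proof -
  have X [measurable]: "X \<in> borel_measurable M" and nonneg: "0 \<le> a \<bullet> (S *v a)"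
    using assms by (auto simp: gaussian0_def pos_semidef_def)
  have "expectation (\<lambda>\<omega>. a \<bullet> X \<omega>) = 0 \<and> integrable M (\<lambda>\<omega>. (a \<bullet> X \<omega>)\<^sup>2) \<and>
    expectation (\<lambda>\<omega>. (a \<bullet> X \<omega>)\<^sup>2) = a \<bullet> (S *v a)"
  \<comment> \<open>A direction of zero variance has no density, and there the moments follow from
    almost sure vanishing; in every other direction they are those of a nondegenerate normal
    law.\<close>
  proof (cases "a \<bullet> (S *v a) = 0")
    case True
    then have ae: "AE \<omega> in M. a \<bullet> X \<omega> = 0"
      using assms by (auto simp: gaussian0_def)
    have "expectation (\<lambda>\<omega>. a \<bullet> X \<omega>) = expectation (\<lambda>_. 0)"
      using ae by (intro integral_cong_AE) auto
    moreover have "expectation (\<lambda>\<omega>. (a \<bullet> X \<omega>)\<^sup>2) = expectation (\<lambda>_. 0)"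
      using ae by (intro integral_cong_AE) auto
    moreover have "integrable M (\<lambda>\<omega>. (a \<bullet> X \<omega>)\<^sup>2) \<longleftrightarrow> integrable M (\<lambda>_. 0::real)"
      using ae by (intro integrable_cong_AE) auto
    ultimately show ?thesis using True by simp
  next
    case False
    with nonneg have pos: "0 < sqrt (a \<bullet> (S *v a))" by simp
    have "distributed M lborel (\<lambda>\<omega>. a \<bullet> X \<omega>) (normal_density 0 (sqrt (a \<bullet> (S *v a))))"
      using assms False by (auto simp: gaussian0_def)
    from normal_second_moment[OF pos this] nonneg show ?thesis by simp
  qed
  then show "expectation (\<lambda>\<omega>. a \<bullet> X \<omega>) = 0" "integrable M (\<lambda>\<omega>. (a \<bullet> X \<omega>)\<^sup>2)"
    "expectation (\<lambda>\<omega>. (a \<bullet> X \<omega>)\<^sup>2) = a \<bullet> (S *v a)"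
    by auto
qed

lemma gaussian0_square_integrable: "gaussian0 M S X \<Longrightarrow> square_integrable M X"
  using gaussian0_functional(2)[of S X "axis _ 1"]
  by (simp add: square_integrable_def inner_axis' gaussian0_def)

lemma gaussian0_expectation: "gaussian0 M S X \<Longrightarrow> expectation (\<lambda>\<omega>. X \<omega> $ i) = 0"
  using gaussian0_functional(1)[of S X "axis i 1"] by (simp add: inner_axis')

text \<open>Polarisation recovers the whole covariance matrix from the variances of linear functionals.\<close>

lemma gaussian0_cross:
  assumes "gaussian0 M S X"
  shows "cross M X X = S"
proof -
  have sq: "square_integrable M X"
    by (rule gaussian0_square_integrable[OF assms])
  \<comment> \<open>Expanding the quadratic form at the sum of two axes yields only
    \<open>S $ i $ j + S $ j $ i\<close>; symmetry then splits this sum into equal halves.\<close>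
  have sym: "S $ i $ j = S $ j $ i" for i j
  proof -
    have "transpose S = S" using assms by (simp add: gaussian0_def pos_semidef_def)
    then have "transpose S $ i $ j = S $ i $ j" by simp
    then show ?thesis by (simp add: transpose_def)
  qed
  have ax: "axis i 1 \<bullet> (S *v axis j 1) = S $ i $ j" for i j
    by (simp add: inner_axis' matrix_vector_mult_basis column_def)
  have diag: "expectation (\<lambda>\<omega>. (X \<omega> $ i)\<^sup>2) = S $ i $ i" for i
    using gaussian0_functional(3)[OF assms, of "axis i 1"] ax by (simp add: inner_axis')
  have "expectation (\<lambda>\<omega>. X \<omega> $ i * X \<omega> $ j) = S $ i $ j" for i j
  proof -
    have i: "integrable M (\<lambda>\<omega>. (X \<omega> $ k)\<^sup>2)" for k
      using sq by (simp add: square_integrable_def)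
    have ij: "integrable M (\<lambda>\<omega>. X \<omega> $ i * X \<omega> $ j)"
      by (rule square_integrable_mult[OF sq sq])
    have "(axis i 1 + axis j 1) \<bullet> (S *v (axis i 1 + axis j 1)) =
        expectation (\<lambda>\<omega>. ((axis i 1 + axis j 1) \<bullet> X \<omega>)\<^sup>2)"
      by (rule gaussian0_functional(3)[OF assms, symmetric])
    also have "\<dots> =
        expectation (\<lambda>\<omega>. (X \<omega> $ i)\<^sup>2 + (X \<omega> $ j)\<^sup>2 + 2 * (X \<omega> $ i * X \<omega> $ j))"
      by (simp add: inner_add_left inner_axis' power2_sum mult.assoc)
    also have "\<dots> = S $ i $ i + S $ j $ j + 2 * expectation (\<lambda>\<omega>. X \<omega> $ i * X \<omega> $ j)"
      by (simp add: i ij diag)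
    finally show ?thesis
      by (simp add: matrix_vector_right_distrib inner_add_left inner_add_right ax sym[of j i])
  qed
  then show ?thesis by (simp add: cross_def vec_eq_iff)
qed

text \<open>Independence factors each expectation, and the Gaussian factor has mean zero, so the
  mean of the other factor is immaterial.\<close>

lemma cross_indep_zero:
  fixes X :: "'i \<Rightarrow> 'a \<Rightarrow> real^'n"
  assumes ind: "indep_vars (\<lambda>_. borel) X UNIV" and "a \<noteq> b"
    and sq: "square_integrable M (X a)" and G: "gaussian0 M S (X b)"
  shows "cross M (X a) (X b) = 0"
proof -
  have "expectation (\<lambda>\<omega>. X a \<omega> $ i * X b \<omega> $ j) = 0" for i j
  proof -
    \<comment> \<open>Restricting the family to two disjoint singletons gives pairwise independence;
      composing with coordinate projections then reaches the scalar entries.\<close>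
    have ab: "indep_var (PiM {a} (\<lambda>_. borel)) (\<lambda>\<omega>. restrict (\<lambda>i. X i \<omega>) {a})
        (PiM {b} (\<lambda>_. borel)) (\<lambda>\<omega>. restrict (\<lambda>i. X i \<omega>) {b})"
      using \<open>a \<noteq> b\<close> by (intro indep_var_restrict[OF ind]) auto
    have meas: "(\<lambda>f. f a $ i) \<in> PiM {a} (\<lambda>_. borel) \<rightarrow>\<^sub>M (borel :: real measure)"
      "(\<lambda>f. f b $ j) \<in> PiM {b} (\<lambda>_. borel) \<rightarrow>\<^sub>M (borel :: real measure)"
      by measurable
    have "indep_var borel (\<lambda>\<omega>. X a \<omega> $ i) borel (\<lambda>\<omega>. X b \<omega> $ j)"
      using indep_var_compose[OF ab meas] by (simp add: comp_def)
    moreover have "integrable M (\<lambda>\<omega>. Y \<omega> $ k)" if "square_integrable M Y"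
      for Y :: "'a \<Rightarrow> real^'n" and k
      using that by (auto simp: square_integrable_def
          intro: square_integrable_imp_integrable[of "\<lambda>\<omega>. Y \<omega> $ k"])
    ultimately show ?thesis
      using sq gaussian0_square_integrable[OF G]
      by (subst indep_var_lebesgue_integral) (auto simp: gaussian0_expectation[OF G])
  qed
  then show ?thesis by (simp add: cross_def vec_eq_iff)
qed

end

section \<open>The estimator recursion and its steady state\<close>

lemma matrix_inv_left: "invertible S \<Longrightarrow> matrix_inv S ** S = mat 1" for S :: "real^'n^'n"
  unfolding invertible_def matrix_inv_def by (rule someI2_ex) auto

lemma matrix_inv_right: "invertible S \<Longrightarrow> S ** matrix_inv S = mat 1" for S :: "real^'n^'n"
  unfolding invertible_def matrix_inv_def by (rule someI2_ex) auto

lemma gain_iff: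
  fixes A S K :: "real^'n^'n"
  assumes "invertible S"
  shows "K = A ** matrix_inv S \<longleftrightarrow> K ** S = A"
  using assms by (metis matrix_inv_left matrix_inv_right matrix_mul_assoc matrix_mul_rid)

lemma fusion_estimator_observed:
  assumes "fusion_estimator Q R obs z rprior rpost K Pprior Ppost" "t \<in> obs" "1 \<le> t"
  shows "K t ** (Pprior t + R) = Pprior t" "Ppost t = (mat 1 - K t) ** Pprior t"
  using assms gain_iff[of "Pprior t + R" "K t" "Pprior t"]
  unfolding fusion_estimator_def by blast+

text \<open>Adding \<open>Q\<close> and skipping an observation both preserve semidefiniteness. At
  an observed step (I-K)A is not even visibly symmetric, so it is rewritten by
  \<open>joseph_form\<close> as a sum of two congruences.\<close>

lemma posterior_pos_semidef:
  assumes est: "fusion_estimator Q R obs z rprior rpost K Pprior Ppost"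
    and Q: "pos_semidef Q" and R: "pos_semidef R"
  shows "pos_semidef (Ppost t)"
proof (induction t)
  case 0
  show ?case using est by (simp add: fusion_estimator_def)
next
  case (Suc t)
  have prior: "pos_semidef (Pprior (Suc t))"
    using est Suc pos_semidef_add Q by (auto simp: fusion_estimator_def)
  show ?case
  proof (cases "Suc t \<in> obs")
    case True
    then have "Ppost (Suc t) =
        (mat 1 - K (Suc t)) ** Pprior (Suc t) ** transpose (mat 1 - K (Suc t)) +
        K (Suc t) ** R ** transpose (K (Suc t))"
      using fusion_estimator_observed[OF est] by (simp add: joseph_form)
    then show ?thesis
      by (simp only: pos_semidef_add pos_semidef_congruence prior R)
  next
    case False
    then show ?thesis
      using est prior by (simp add: fusion_estimator_def)
  qed
qed

text \<open>\<open>Ppost t\<close> equals \<open>Pprior (Suc t) - Q\<close> at every step, so the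
  posteriors converge along all steps; uniqueness of limits along \<open>obs\<close> identifies
  their limit with \<open>P_inf\<close>. The other equations are limits of those at observed
  steps.\<close>

lemma steady_state_limits:
  assumes est: "fusion_estimator Q R obs z rprior rpost K Pprior Ppost"
    and steady: "steady_state R obs K Pprior Ppost K_inf Pprior_inf P_inf"
  shows "Ppost \<longlonglongrightarrow> P_inf" "invertible (P_inf + Q + R)"
    "K_inf ** (P_inf + Q + R) = P_inf + Q" "P_inf = (mat 1 - K_inf) ** (P_inf + Q)"
proof -
  define F where "F = inf sequentially (principal obs)"
  \<comment> \<open>This is where \<open>obs\<close> being infinite enters: limits along a proper
    filter are unique.\<close>
  have F: "F \<noteq> bot"
    using steady
    by (auto simp: F_def steady_state_def trivial_limit_def eventually_inf_principal
        eventually_sequentially infinite_nat_iff_unbounded_le)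
  have K: "(K \<longlongrightarrow> K_inf) F" and post: "(Ppost \<longlongrightarrow> P_inf) F"
    and prior: "Pprior \<longlonglongrightarrow> Pprior_inf" and inv: "invertible (Pprior_inf + R)"
    using steady by (auto simp: F_def steady_state_def)
  have "Ppost = (\<lambda>t. Pprior (Suc t) - Q)"
    using est by (auto simp: fusion_estimator_def)
  then have Ppost: "Ppost \<longlonglongrightarrow> Pprior_inf - Q"
    using tendsto_diff[OF LIMSEQ_Suc[OF prior] tendsto_const] by simp
  then have "(Ppost \<longlongrightarrow> Pprior_inf - Q) F"
    unfolding F_def by (rule tendsto_mono[OF inf_le1])
  with post F have "P_inf = Pprior_inf - Q"
    using tendsto_unique by blast
  then have P: "Pprior_inf = P_inf + Q" by simp
  show "Ppost \<longlonglongrightarrow> P_inf" using Ppost P by simp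
  show "invertible (P_inf + Q + R)" using inv P by simp
  have prior: "(Pprior \<longlongrightarrow> P_inf + Q) F"
    using prior P unfolding F_def by (auto intro: tendsto_mono[OF inf_le1])
  \<comment> \<open>The rectification equations hold at observed steps from index 1 on, which is
    eventually the case along \<open>F\<close>.\<close>
  have obs: "\<forall>\<^sub>F t in F. t \<in> obs \<and> 1 \<le> t"
    unfolding F_def eventually_inf_principal using eventually_ge_at_top[of 1]
    by eventually_elim simp
  have "((\<lambda>t. K t ** (Pprior t + R)) \<longlongrightarrow> K_inf ** (P_inf + Q + R)) F"
    by (intro tendsto_matrix_mult tendsto_add K prior tendsto_const)
  moreover have "\<forall>\<^sub>F t in F. K t ** (Pprior t + R) = Pprior t"
    using obs by eventually_elim (simp add: fusion_estimator_observed[OF est])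
  ultimately have "(Pprior \<longlongrightarrow> K_inf ** (P_inf + Q + R)) F"
    by (simp add: tendsto_cong)
  with prior F show "K_inf ** (P_inf + Q + R) = P_inf + Q"
    using tendsto_unique by blast
  have "((\<lambda>t. (mat 1 - K t) ** Pprior t) \<longlongrightarrow> (mat 1 - K_inf) ** (P_inf + Q)) F"
    by (intro tendsto_matrix_mult tendsto_diff K prior tendsto_const)
  moreover have "\<forall>\<^sub>F t in F. (mat 1 - K t) ** Pprior t = Ppost t"
    using obs by eventually_elim (simp add: fusion_estimator_observed[OF est])
  ultimately have "(Ppost \<longlongrightarrow> (mat 1 - K_inf) ** (P_inf + Q)) F"
    by (simp add: tendsto_cong)
  with post F show "P_inf = (mat 1 - K_inf) ** (P_inf + Q)"
    using tendsto_unique by blast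
qed

lemma posterior_less_zoh:
  fixes P Q R K :: "real^'n^'n"
  assumes P: "P = (mat 1 - K) ** (P + Q)" and K: "K ** (P + Q + R) = P + Q"
    and psd: "pos_semidef P" and R: "pos_semidef R" and Q: "pos_def Q"
  shows "pd_less P (Q + R)"
proof -
  have Q': "pos_semidef Q"
    using Q unfolding pos_def_def pos_semidef_def by (metis inner_zero_left less_imp_le order_refl)
  then have "transpose (P + Q) = P + Q" "transpose R = R"
    using psd R by (simp_all add: pos_semidef_def transpose_add)
  from noise_minus_posterior[OF K this]
  have "R - P = (mat 1 - K) ** (P + Q + R) ** transpose (mat 1 - K)"
    using P by simp
  moreover have "pos_semidef \<dots>"
    by (intro pos_semidef_congruence pos_semidef_add psd R Q')
  \<comment> \<open>\<open>R - P\<close> is only shown semidefinite; strictness comes from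
    \<open>Q\<close>.\<close>
  ultimately have "pos_def (Q + (R - P))"
    using Q pos_def_add_pos_semidef by metis
  then show ?thesis
    by (simp add: pd_less_def algebra_simps)
qed

section \<open>Error covariances of the estimator and of the zero-order heuristic\<close>

context prob_space
begin

text \<open>The two mixed terms are transposes of each other, so both vanish.\<close>

lemma cross_add_uncorrelated:
  assumes "square_integrable M X" "square_integrable M Y" "cross M X Y = 0"
  shows "cross M (\<lambda>\<omega>. X \<omega> + Y \<omega>) (\<lambda>\<omega>. X \<omega> + Y \<omega>) = cross M X X + cross M Y Y"
proof -
  have "cross M Y X = transpose (cross M X Y)" by (simp add: transpose_cross)
  also have "\<dots> = 0" by (simp add: assms transpose_def vec_eq_iff)
  finally show ?thesis
    using assms by (simp add: cross_add_left cross_add_right square_integrable_add)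
qed

lemma cross_diff_uncorrelated:
  assumes "square_integrable M X" "square_integrable M Y" "cross M X Y = 0"
  shows "cross M (\<lambda>\<omega>. X \<omega> - Y \<omega>) (\<lambda>\<omega>. X \<omega> - Y \<omega>) = cross M X X + cross M Y Y"
proof -
  have "cross M Y X = transpose (cross M X Y)" by (simp add: transpose_cross)
  also have "\<dots> = 0" by (simp add: assms transpose_def vec_eq_iff)
  finally show ?thesis
    using assms by (simp add: cross_diff_left cross_diff_right square_integrable_diff)
qed

lemma random_walk_model_noise:
  assumes "random_walk_model M Q R obs w v r z"
  shows "square_integrable M (w t)" "square_integrable M (v t)"
    "cross M (w t) (w t) = Q" "cross M (v t) (v t) = R"
    "s \<noteq> t \<Longrightarrow> cross M (w t) (w s) = 0" "s \<noteq> t \<Longrightarrow> cross M (v t) (v s) = 0"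
    "cross M (w t) (v s) = 0" "cross M (v t) (w s) = 0"
proof -
  have w: "gaussian0 M Q (w t)" and v: "gaussian0 M R (v t)" for t
    using assms by (auto simp: random_walk_model_def)
  have ind: "indep_vars (\<lambda>_. borel) (case_sum w v) UNIV"
    using assms by (auto simp: random_walk_model_def)
  show sqw: "square_integrable M (w t)" and sqv: "square_integrable M (v t)"
    using w v gaussian0_square_integrable by blast+
  show "cross M (w t) (w t) = Q" "cross M (v t) (v t) = R"
    using w v gaussian0_cross by blast+
  show "cross M (w t) (w s) = 0" if "s \<noteq> t"
    using cross_indep_zero[OF ind, of "Inl t" "Inl s" Q] that w sqw by simp
  show "cross M (v t) (v s) = 0" if "s \<noteq> t"
    using cross_indep_zero[OF ind, of "Inr t" "Inr s" R] that v sqv by simp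
  show "cross M (w t) (v s) = 0"
    using cross_indep_zero[OF ind, of "Inl t" "Inr s" R] v sqw by simp
  show "cross M (v t) (w s) = 0"
    using cross_indep_zero[OF ind, of "Inr t" "Inl s" Q] w sqv by simp
qed

lemma initial_error:
  assumes model: "random_walk_model M Q R obs w v r z"
    and init: "initial_uncertainty M w v est0 x0 P0"
  defines "e \<equiv> \<lambda>\<omega>. est0 \<omega> - x0 \<omega>"
  shows "square_integrable M e" "cross M e e = P0" "cross M e (w s) = 0"
    "0 < s \<Longrightarrow> cross M e (v s) = 0"
proof -
  have ind: "indep_vars (\<lambda>_. borel) (case_option e (case_sum w (\<lambda>t. v (Suc t)))) UNIV"
    using init by (simp add: initial_uncertainty_def e_def)
  have int: "integrable M (\<lambda>\<omega>. outer (e \<omega>))"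
    using init by (simp add: initial_uncertainty_def e_def finite_error_variance_def)
  \<comment> \<open>Measurability of the initial error is read off from its membership in an
    independent family.\<close>
  have "case_option e (case_sum w (\<lambda>t. v (Suc t))) None \<in> borel_measurable M"
    using ind unfolding indep_vars_def by blast
  then show sq: "square_integrable M e"
    using int by (intro square_integrable_of_outer) simp_all
  show "cross M e e = P0"
    using init integral_outer[OF int]
    by (simp add: initial_uncertainty_def error_variance_def e_def)
  show "cross M e (w s) = 0"
    using cross_indep_zero[OF ind, of None "Some (Inl s)" Q] sq model
    by (simp add: random_walk_model_def)
  \<comment> \<open>The family lists \<open>v (Suc t)\<close> at index \<open>t\<close>, so
    \<open>v s\<close> sits at index \<open>s - 1\<close>.\<close>
  show "cross M e (v s) = 0" if "0 < s"
    using cross_indep_zero[OF ind, of None "Some (Inr (s - 1))" R] sq model that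
    by (simp add: random_walk_model_def)
qed

text \<open>
  The recursion for the covariance only needs the current error to be uncorrelated with the noise
  still to come, and this property, unlike independence, propagates by bilinearity alone.
\<close>

lemma estimation_error_covariance:
  fixes Q R :: "real^'n^'n"
  assumes model: "random_walk_model M Q R obs w v r z"
    and est: "fusion_estimator Q R obs z rprior rpost K Pprior Ppost"
    and init: "initial_uncertainty M w v (rpost 0) (r 0) (Ppost 0)"
  defines "e \<equiv> \<lambda>t \<omega>. rpost t \<omega> - r t \<omega>"
  shows "square_integrable M (e t) \<and> cross M (e t) (e t) = Ppost t \<and>
    (\<forall>s\<ge>t. cross M (e t) (w s) = 0) \<and> (\<forall>s>t. cross M (e t) (v s) = 0)"
\<comment> \<open>The two ranges differ because \<open>w t\<close> acts only in the passage to
  \<open>Suc t\<close>, whereas \<open>v t\<close> may already have entered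
  \<open>rpost t\<close>.\<close>
proof (induction t)
  case 0
  show ?case
    using initial_error[OF model init] by (simp add: e_def)
next
  case (Suc t)
  note noise = random_walk_model_noise[OF model]
  \<comment> \<open>The prior error at \<open>Suc t\<close>: the estimate is carried over while the
    state moves by \<open>w t\<close>.\<close>
  define d where "d = (\<lambda>\<omega>. e t \<omega> - w t \<omega>)"
  have d: "square_integrable M d"
    unfolding d_def using Suc noise by (intro square_integrable_diff) auto
  have "cross M d d = Ppost t + Q"
    unfolding d_def using Suc noise by (simp add: cross_diff_uncorrelated)
  then have dd: "cross M d d = Pprior (Suc t)"
    using est by (simp add: fusion_estimator_def)
  have dw: "cross M d (w s) = 0" if "s \<ge> Suc t" for s
    unfolding d_def using Suc noise that by (simp add: cross_diff_left)
  have dv: "cross M d (v s) = 0" if "s \<ge> Suc t" for s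
    unfolding d_def using Suc noise that by (simp add: cross_diff_left)
  have prior: "d = (\<lambda>\<omega>. rprior (Suc t) \<omega> - r (Suc t) \<omega>)"
    using est model by (auto simp: d_def e_def fusion_estimator_def random_walk_model_def)
  show ?case
  proof (cases "Suc t \<in> obs")
    case False
    then have "e (Suc t) = d" "Ppost (Suc t) = Pprior (Suc t)"
      using est by (auto simp: prior e_def fusion_estimator_def)
    then show ?thesis
      using d dd dw dv by simp
  next
    case True
    define L N where "L = mat 1 - K (Suc t)" and "N = K (Suc t)"
    define a b where "a = (\<lambda>\<omega>. L *v d \<omega>)" and "b = (\<lambda>\<omega>. N *v v (Suc t) \<omega>)"
    have "rpost (Suc t) \<omega> = L *v rprior (Suc t) \<omega> + N *v (r (Suc t) \<omega> + v (Suc t) \<omega>)" for \<omega>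
      using est model True by (simp add: L_def N_def fusion_estimator_def random_walk_model_def)
    \<comment> \<open>As \<open>L + N = mat 1\<close>, the true state cancels, leaving the damped
      prior error plus the noise weighted by the gain.\<close>
    then have e: "e (Suc t) = (\<lambda>\<omega>. a \<omega> + b \<omega>)"
      by (auto simp: e_def a_def b_def prior L_def N_def algebra_simps)
    have ab: "square_integrable M a" "square_integrable M b"
      unfolding a_def b_def using d noise by (auto intro: square_integrable_matrix_vector)
    have cross_a: "cross M a Y = L ** cross M d Y" if "square_integrable M Y"
      for Y :: "'a \<Rightarrow> real^'n"
      unfolding a_def using cross_matrix_vector_left d that by blast
    have cross_b: "cross M b Y = N ** cross M (v (Suc t)) Y" if "square_integrable M Y"
      for Y :: "'a \<Rightarrow> real^'n"
      unfolding b_def using cross_matrix_vector_left noise that by blast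
    have "cross M a a = L ** Pprior (Suc t) ** transpose L"
      unfolding cross_a[OF ab(1)] unfolding a_def
      using d by (simp add: cross_matrix_vector_right dd matrix_mul_assoc)
    moreover have "cross M b b = N ** R ** transpose N"
      unfolding cross_b[OF ab(2)] unfolding b_def
      using noise by (simp add: cross_matrix_vector_right matrix_mul_assoc)
    moreover have "cross M a b = 0"
      unfolding cross_a[OF ab(2)] unfolding b_def
      using d noise by (simp add: cross_matrix_vector_right dv)
    ultimately have "cross M (e (Suc t)) (e (Suc t)) =
        L ** Pprior (Suc t) ** transpose L + N ** R ** transpose N"
      unfolding e using ab by (simp add: cross_add_uncorrelated)
    also have "\<dots> = Ppost (Suc t)"
      using fusion_estimator_observed[OF est True] by (simp add: L_def N_def joseph_form)
    finally have "cross M (e (Suc t)) (e (Suc t)) = Ppost (Suc t)" .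
    moreover have "cross M (e (Suc t)) (w s) = 0" if "s \<ge> Suc t" for s
      unfolding e using ab noise dw[OF that] by (simp add: cross_add_left cross_a cross_b)
    moreover have "cross M (e (Suc t)) (v s) = 0" if "s > Suc t" for s
      unfolding e using ab noise dv[of s] that by (simp add: cross_add_left cross_a cross_b)
    moreover have "square_integrable M (e (Suc t))"
      unfolding e using ab by (rule square_integrable_add)
    ultimately show ?thesis by blast
  qed
qed

lemma zoh_error_variance:
  assumes model: "random_walk_model M Q R obs w v r z" and "1 \<le> t" "t - 1 \<in> obs"
  shows "finite_error_variance M (zoh z t) (r t) \<and> error_variance M (zoh z t) (r t) = Q + R"
proof -
  obtain s where t: "t = Suc s" using \<open>1 \<le> t\<close> by (cases t) auto
  note noise = random_walk_model_noise[OF model]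
  have "(\<lambda>\<omega>. zoh z t \<omega> - r t \<omega>) = (\<lambda>\<omega>. v s \<omega> - w s \<omega>)"
    using assms by (auto simp: t zoh_def random_walk_model_def)
  then have "(\<lambda>\<omega>. outer (zoh z t \<omega> - r t \<omega>)) = (\<lambda>\<omega>. outer (v s \<omega> - w s \<omega>))"
    by (simp add: fun_eq_iff)
  \<comment> \<open>Integrability must be established first, since otherwise the integral could be 0
    by convention.\<close>
  moreover have int: "integrable M (\<lambda>\<omega>. outer (v s \<omega> - w s \<omega>))"
    using noise by (intro integrable_outer square_integrable_diff) auto
  moreover have "(\<integral>\<omega>. outer (v s \<omega> - w s \<omega>) \<partial>M) = Q + R"
    unfolding integral_outer[OF int] using noise by (simp add: cross_diff_uncorrelated add.commute)
  ultimately show ?thesis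
    unfolding finite_error_variance_def error_variance_def by simp
qed

end

theorem theorem3p2:
  fixes M :: "'a measure"
    and Q R :: "real^'n^'n"
    and obs :: "nat set"
    and w v r z rprior rpost :: "nat \<Rightarrow> 'a \<Rightarrow> real^'n"
    and K Pprior Ppost :: "nat \<Rightarrow> real^'n^'n"
    and K_inf Pprior_inf P_inf :: "real^'n^'n"
  assumes model: "random_walk_model M Q R obs w v r z"
    and estimator: "fusion_estimator Q R obs z rprior rpost K Pprior Ppost"
    and steady: "steady_state R obs K Pprior Ppost K_inf Pprior_inf P_inf"
  shows
    "P_inf = (mat 1 - K_inf) ** (P_inf + Q) \<and>
     K_inf = (P_inf + Q) ** matrix_inv (P_inf + Q + R) \<and>
     invertible (P_inf + Q + R) \<and>
     (CARD('n) = 1 \<longrightarrow>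
        (\<forall>i. (P_inf $ i $ i)\<^sup>2 + Q $ i $ i * P_inf $ i $ i - Q $ i $ i * R $ i $ i = 0)) \<and>
     (initial_uncertainty M w v (rpost 0) (r 0) (Ppost 0) \<longrightarrow>
        (\<forall>t. finite_error_variance M (rpost t) (r t) \<and>
             error_variance M (rpost t) (r t) = Ppost t)) \<and>
     (\<forall>t\<ge>1. t - 1 \<in> obs \<longrightarrow>
        finite_error_variance M (zoh z t) (r t) \<and>
        error_variance M (zoh z t) (r t) = Q + R) \<and>
     (pos_def R \<and> pos_def Q \<longrightarrow>
        (\<forall>t\<ge>1. t - 1 \<in> obs \<longrightarrow> pd_less P_inf (error_variance M (zoh z t) (r t))))"
proof -
  interpret prob_space M
    using model by (simp add: random_walk_model_def)
  note limits = steady_state_limits[OF estimator steady]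
  have psd: "pos_semidef Q" "pos_semidef R"
    using model by (auto simp: random_walk_model_def gaussian0_def)
  have P_psd: "pos_semidef P_inf"
    using posterior_pos_semidef[OF estimator psd]
    by (intro pos_semidef_limit[OF limits(1)]) simp_all
  have gain: "K_inf = (P_inf + Q) ** matrix_inv (P_inf + Q + R)"
    using limits by (simp add: gain_iff)
  have scalar: "CARD('n) = 1 \<Longrightarrow>
      (P_inf $ i $ i)\<^sup>2 + Q $ i $ i * P_inf $ i $ i - Q $ i $ i * R $ i $ i = 0" for i
    using limits by (intro riccati_scalar)
  \<comment> \<open>With the convergence of \<open>Ppost\<close>, this makes \<open>P_inf\<close> a
    limit of true error variances and not just of a matrix recursion.\<close>
  have error: "finite_error_variance M (rpost t) (r t) \<and> error_variance M (rpost t) (r t) = Ppost t"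
    if "initial_uncertainty M w v (rpost 0) (r 0) (Ppost 0)" for t
    using estimation_error_covariance[OF model estimator that, of t]
    by (auto simp: finite_error_variance_def error_variance_def integrable_outer integral_outer)
  have less: "pd_less P_inf (Q + R)" if "pos_def Q"
    using posterior_less_zoh limits P_psd psd that by blast
  show ?thesis
  proof (intro conjI allI impI)
    show "P_inf = (mat 1 - K_inf) ** (P_inf + Q)" "invertible (P_inf + Q + R)"
      by (fact limits)+
    show "K_inf = (P_inf + Q) ** matrix_inv (P_inf + Q + R)"
      by (fact gain)
    show "pd_less P_inf (error_variance M (zoh z t) (r t))"
      if "pos_def R \<and> pos_def Q" "1 \<le> t" "t - 1 \<in> obs" for t
      using that less zoh_error_variance[OF model] by simp
  qed (simp_all add: scalar error zoh_error_variance[OF model])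
qed

end
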